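(* Let $X$ be a reflexive Banach space, let $\varphi:X\to\mathbb{R}\cup\{+\infty\}$ be proper, convex and lower semi-continuous, and let $A:D(A)\subset X\to X^*$ be a skew-adjoint operator modulo the boundary operators $(b_1,b_2):D(b_1,b_2)\subset X\to H_1\times H_2$, where $H_1,H_2$ are two Hilbert spaces. Suppose there exist a constant $C>0$ and $p_1,p_2>0$ such that for every $x\in X$, $$\frac1C\left(\|x\|_X^{p_1}-1\right)\le\varphi(x)\le C\left(\|x\|_X^{p_2}+1\right).$$ Then there exists $\overline x\in D(A)\cap D(b_1,b_2)$ such that $$\varphi(\overline x)+\varphi^*(-A\overline x)+\frac12\|b_1(\overline x)\|_{H_1}^2+\frac12\|b_2(\overline x)\|_{H_2}^2=0,$$ $$-A\overline x\in\partial\varphi(\overline x)\quad\text{and}\quad b_2(\overline x)=0.$$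
   Context: All spaces are real. $\varphi^*$ is the Legendre–Fenchel conjugate of $\varphi$ on $X^*$ and $\partial\varphi$ its convex subdifferential. Let $A$ be a linear (possibly unbounded) map from its domain $D(A)\subset X$ into $X^*$, and let $(b_1,b_2)$ be a pair of linear maps from a domain $D(b_1,b_2)\subset X$ into $H_1\times H_2$. $A$ is skew-adjoint modulo the boundary operators $(b_1,b_2)$ if: (1) $S:=D(A)\cap D(b_1,b_2)$ is dense in $X$; (2) $X_0:=\mathrm{Ker}(b_1,b_2)\cap D(A)$ is dense in $X$; (3) the image of $S$ by $(b_1,b_2)$ is dense in $H_1\times H_2$; (4) an element $y\in X$ belongs to $S$ if and only if $\sup\{\langle y,Ax\rangle-\frac12(\|b_1(x)\|_{H_1}^2+\|b_2(x)\|_{H_2}^2): x\in S,\ \|x\|_X<1\}<\infty$; (5) for all $x,y\in S$, $\langle y,Ax\rangle=-\langle Ay,x\rangle+\langle b_1(x),b_1(y)\rangle_{H_1}-\langle b_2(x),b_2(y)\rangle_{H_2}$. *)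

theory Defs
  imports "HOL-Analysis.Analysis"
begin

text \<open>The dual of a real normed space \<open>'a\<close> is the type \<open>'a \<Rightarrow>\<^sub>L real\<close> of bounded linear
  functionals with the operator norm; the pairing \<open>\<langle>x, p\<rangle>\<close> is \<open>blinfun_apply p x\<close>.\<close>

definition canonical_embedding :: "'a::real_normed_vector \<Rightarrow> (('a \<Rightarrow>\<^sub>L real) \<Rightarrow>\<^sub>L real)"
  where "canonical_embedding x = Blinfun (\<lambda>p. blinfun_apply p x)"

lemma canonical_embedding_apply [simp]:
  "blinfun_apply (canonical_embedding x) p = blinfun_apply p x"
  unfolding canonical_embedding_def
  by (subst bounded_linear_Blinfun_apply)
    (auto intro: blinfun.bounded_linear_left)

text \<open>Reflexivity is a property of the type \<open>'a\<close>, hence the \<open>itself\<close> argument.\<close>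

definition reflexive_space :: "'a::real_normed_vector itself \<Rightarrow> bool"
  where "reflexive_space _ \<longleftrightarrow>
    surj (canonical_embedding :: 'a \<Rightarrow> (('a \<Rightarrow>\<^sub>L real) \<Rightarrow>\<^sub>L real))"

text \<open>Functions with values in \<open>\<real> \<union> {+\<infinity>}\<close> are \<open>ereal\<close>-valued functions that avoid \<open>-\<infinity>\<close>;
  this is part of properness.\<close>

definition proper_fun :: "('a \<Rightarrow> ereal) \<Rightarrow> bool"
  where "proper_fun \<phi> \<longleftrightarrow> (\<forall>x. \<phi> x \<noteq> -\<infinity>) \<and> (\<exists>x. \<phi> x \<noteq> \<infinity>)"

text \<open>Only meant for functions avoiding \<open>-\<infinity>\<close>. The endpoints \<open>u = 0\<close> and \<open>v = 0\<close> are harmless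
  because \<open>0 * \<infinity> = 0\<close> in \<open>ereal\<close>.\<close>

definition convex_fun :: "('a::real_vector \<Rightarrow> ereal) \<Rightarrow> bool"
  where "convex_fun \<phi> \<longleftrightarrow>
    (\<forall>x y u v. 0 \<le> u \<longrightarrow> 0 \<le> v \<longrightarrow> u + v = 1 \<longrightarrow>
      \<phi> (u *\<^sub>R x + v *\<^sub>R y) \<le> ereal u * \<phi> x + ereal v * \<phi> y)"

definition lsc_fun :: "('a::topological_space \<Rightarrow> ereal) \<Rightarrow> bool"
  where "lsc_fun \<phi> \<longleftrightarrow> (\<forall>x. \<phi> x \<le> Liminf (at x) \<phi>)"

definition fenchel_conjugate :: "('a::real_normed_vector \<Rightarrow> ereal) \<Rightarrow> ('a \<Rightarrow>\<^sub>L real) \<Rightarrow> ereal"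
  where "fenchel_conjugate \<phi> p = (SUP x. ereal (blinfun_apply p x) - \<phi> x)"

definition subdifferential :: "('a::real_normed_vector \<Rightarrow> ereal) \<Rightarrow> 'a \<Rightarrow> ('a \<Rightarrow>\<^sub>L real) set"
  where "subdifferential \<phi> x =
    {p. \<bar>\<phi> x\<bar> \<noteq> \<infinity> \<and> (\<forall>y. \<phi> x + ereal (blinfun_apply p (y - x)) \<le> \<phi> y)}"

text \<open>A linear map defined on a subspace \<open>D\<close> is represented by a total function whose values
  outside \<open>D\<close> are irrelevant.\<close>

definition linear_map_on :: "'a::real_vector set \<Rightarrow> ('a \<Rightarrow> 'b::real_vector) \<Rightarrow> bool"
  where "linear_map_on D f \<longleftrightarrow> subspace D \<and>
    (\<forall>x\<in>D. \<forall>y\<in>D. f (x + y) = f x + f y) \<and>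
    (\<forall>c. \<forall>x\<in>D. f (c *\<^sub>R x) = c *\<^sub>R f x)"

text \<open>\<open>DA\<close> is the domain of \<open>A\<close> and \<open>Db\<close> the common domain of the pair \<open>(b1, b2)\<close>.\<close>

definition skew_adjoint_modulo ::
  "'a::real_normed_vector set \<Rightarrow> ('a \<Rightarrow> ('a \<Rightarrow>\<^sub>L real)) \<Rightarrow>
   'a set \<Rightarrow> ('a \<Rightarrow> 'h1::real_inner) \<Rightarrow> ('a \<Rightarrow> 'h2::real_inner) \<Rightarrow> bool"
  where "skew_adjoint_modulo DA A Db b1 b2 \<longleftrightarrow>
    linear_map_on DA A \<and> linear_map_on Db (\<lambda>x. (b1 x, b2 x)) \<and>
    (let S = DA \<inter> Db in
      closure S = UNIV \<and>
      closure ({x \<in> Db. b1 x = 0 \<and> b2 x = 0} \<inter> DA) = UNIV \<and>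
      closure ((\<lambda>x. (b1 x, b2 x)) ` S) = UNIV \<and>
      (\<forall>y. y \<in> S \<longleftrightarrow>
        (SUP x\<in>{x \<in> S. norm x < 1}.
          ereal (blinfun_apply (A x) y - 1/2 * ((norm (b1 x))\<^sup>2 + (norm (b2 x))\<^sup>2))) < \<infinity>) \<and>
      (\<forall>x\<in>S. \<forall>y\<in>S. blinfun_apply (A x) y =
        - blinfun_apply (A y) x + b1 x \<bullet> b1 y - b2 x \<bullet> b2 y))"

end

theory Submission
  imports Defs
begin

text \<open>
  On \<open>S = DA \<inter> Db\<close> put \<open>B x = (|b1 x|^2 + |b2 x|^2) / 2\<close>. The convex function
  \<open>h p = inf {\<phi> x + \<phi>* (p - A x) + B x | x \<in> S}\<close> satisfies \<open>h 0 \<ge> 0\<close> by the Fenchel inequality,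
  and it is bounded above near \<open>0\<close> because \<open>\<phi>\<close> is coercive; by Hahn-Banach and reflexivity some
  \<open>y\<close> satisfies \<open>\<langle>y, p\<rangle> \<le> h p\<close> for all \<open>p\<close>. Inserting a subgradient of \<open>\<phi>\<close> at \<open>y\<close> gives
  \<open>\<phi> y + \<langle>y, A x\<rangle> \<le> \<phi> x + B x\<close> on \<open>S\<close>, and since \<open>\<phi>\<close> is bounded on the unit ball, condition (4)
  puts \<open>y\<close> into \<open>S\<close>. Now Green's formula (5) applies, and by conditions (2) and (3) the triples
  \<open>(x, b1 x, b2 x)\<close> are dense, so they may be replaced by arbitrary \<open>(z, b1 y, - b2 y)\<close>. The result
  \<open>\<phi> y + \<phi>* (- A y) + B y \<le> 0\<close> is the reverse of the Fenchel inequality, which bounds the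
  left-hand side below by \<open>|b2 y|^2\<close>.
\<close>

section \<open>Hahn-Banach theorem below a convex set\<close>

text \<open>\<open>K\<close> stands in for the epigraph of a convex function, so that neither infima
  nor infinite values occur. Zorn's lemma gives a maximal subspace of the product lying below
  \<open>K\<close>, and this subspace turns out to be the graph of \<open>l\<close>.\<close>

lemma hahn_banach_convex_set:
  fixes K :: "('a::real_vector \<times> real) set"
  assumes K: "convex K"
    and absorbing: "\<And>v. \<exists>t>0. \<exists>c. (t *\<^sub>R v, c) \<in> K"
    and zero: "\<And>c. (0, c) \<in> K \<Longrightarrow> 0 \<le> c"
  shows "\<exists>l. linear l \<and> (\<forall>v c. (v, c) \<in> K \<longrightarrow> l v \<le> c)"
proof -
  define \<A> where "\<A> = {G. subspace G \<and> (\<forall>u a c. (u, a) \<in> G \<longrightarrow> (u, c) \<in> K \<longrightarrow> a \<le> c)}"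
  have "{0} \<in> \<A>"
    using zero by (auto simp: \<A>_def zero_prod_def subspace_def)
  moreover have "\<Union>\<C> \<in> \<A>" if "\<C> \<noteq> {}" and "subset.chain \<A> \<C>" for \<C>
  proof -
    have sub: "\<And>G. G \<in> \<C> \<Longrightarrow> G \<in> \<A>" and chain: "\<And>G H. G \<in> \<C> \<Longrightarrow> H \<in> \<C> \<Longrightarrow> G \<subseteq> H \<or> H \<subseteq> G"
      using that(2) by (auto simp: subset.chain_def)
    have "subspace (\<Union>\<C>)"
      unfolding subspace_def
    proof (intro conjI ballI allI)
      show "0 \<in> \<Union>\<C>"
        using that(1) sub by (auto simp: \<A>_def dest: subspace_0)
    next
      fix x y assume "x \<in> \<Union>\<C>" "y \<in> \<Union>\<C>"
      then obtain G where "G \<in> \<C>" "x \<in> G" "y \<in> G"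
        using chain by blast
      then show "x + y \<in> \<Union>\<C>"
        using sub by (auto simp: \<A>_def intro: subspace_add)
    next
      fix c x assume "x \<in> \<Union>\<C>"
      then show "c *\<^sub>R x \<in> \<Union>\<C>"
        using sub by (auto simp: \<A>_def intro: subspace_scale)
    qed
    then show ?thesis
      using sub by (fastforce simp: \<A>_def)
  qed
  ultimately obtain G where G: "G \<in> \<A>" and max: "\<And>H. H \<in> \<A> \<Longrightarrow> G \<subseteq> H \<Longrightarrow> H = G"
    using subset_Zorn_nonempty[of \<A>] by blast
  then have subG: "subspace G" and below: "\<And>u a c. (u, a) \<in> G \<Longrightarrow> (u, c) \<in> K \<Longrightarrow> a \<le> c"
    by (auto simp: \<A>_def)
  \<comment> \<open>Such a \<open>G\<close> is automatically a graph, so the one-dimensional extension step does not need \<open>v\<close> to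
    lie outside its domain.\<close>
  have total: "\<exists>a. (v, a) \<in> G" for v
  proof -
    \<comment> \<open>These are the constraints on a value \<open>a\<close> at \<open>v\<close>:
      points of \<open>G\<close> shifted by a negative multiple of \<open>(v, a)\<close> stay below
      \<open>K\<close> when \<open>a\<close> exceeds all of \<open>lower\<close>, those shifted by a
      positive multiple when \<open>a\<close> is below all of \<open>upper\<close>.\<close>
    define lower where "lower = {(b - c) / s | u b c s. 0 < s \<and> (u, b) \<in> G \<and> (u - s *\<^sub>R v, c) \<in> K}"
    define upper where "upper = {(d - b) / t | w b d t. 0 < t \<and> (w, b) \<in> G \<and> (w + t *\<^sub>R v, d) \<in> K}"
    have zero_G: "(0, 0) \<in> G"
      using subspace_0[OF subG] by (simp add: zero_prod_def)
    have nonempty: "lower \<noteq> {}" "upper \<noteq> {}"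
    proof -
      obtain t c where "t > 0" "(t *\<^sub>R (- v), c) \<in> K"
        using absorbing by blast
      then have "(0 - t *\<^sub>R v, c) \<in> K" by simp
      then have "(0 - c) / t \<in> lower"
        unfolding lower_def using zero_G \<open>t > 0\<close> by blast
      then show "lower \<noteq> {}" by blast
      obtain t c where "t > 0" "(t *\<^sub>R v, c) \<in> K"
        using absorbing by blast
      then have "(0 + t *\<^sub>R v, c) \<in> K" by simp
      then have "(c - 0) / t \<in> upper"
        unfolding upper_def using zero_G \<open>t > 0\<close> by blast
      then show "upper \<noteq> {}" by blast
    qed
    have le: "x \<le> y" if "x \<in> lower" "y \<in> upper" for x y
    proof -
      obtain u b c s where x: "x = (b - c) / s" "0 < s" "(u, b) \<in> G" "(u - s *\<^sub>R v, c) \<in> K"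
        using \<open>x \<in> lower\<close> unfolding lower_def by auto
      obtain w b' d t where y: "y = (d - b') / t" "0 < t" "(w, b') \<in> G" "(w + t *\<^sub>R v, d) \<in> K"
        using \<open>y \<in> upper\<close> unfolding upper_def by auto
      \<comment> \<open>The weights make the two multiples of \<open>v\<close> cancel, so the convex
        combination can be compared with a point of \<open>G\<close> over the same base
        point.\<close>
      define \<alpha> where "\<alpha> = t / (s + t)"
      define \<beta> where "\<beta> = s / (s + t)"
      have \<alpha>\<beta>: "0 \<le> \<alpha>" "0 \<le> \<beta>" "\<alpha> + \<beta> = 1" and eq: "\<alpha> * s = \<beta> * t"
        using x(2) y(2) by (auto simp: \<alpha>_def \<beta>_def simp flip: add_divide_distrib)
      have "\<alpha> *\<^sub>R (u - s *\<^sub>R v, c) + \<beta> *\<^sub>R (w + t *\<^sub>R v, d) \<in> K"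
        using K x(4) y(4) \<alpha>\<beta> by (rule convexD)
      then have "(\<alpha> *\<^sub>R u + \<beta> *\<^sub>R w, \<alpha> * c + \<beta> * d) \<in> K"
        using eq by (simp add: algebra_simps)
      moreover have "\<alpha> *\<^sub>R (u, b) + \<beta> *\<^sub>R (w, b') \<in> G"
        using subG x(3) y(3) by (intro subspace_add subspace_scale)
      then have "(\<alpha> *\<^sub>R u + \<beta> *\<^sub>R w, \<alpha> * b + \<beta> * b') \<in> G"
        by simp
      ultimately have "\<alpha> * b + \<beta> * b' \<le> \<alpha> * c + \<beta> * d"
        using below by blast
      then have "(t * b + s * b') / (s + t) \<le> (t * c + s * d) / (s + t)"
        by (simp add: \<alpha>_def \<beta>_def add_divide_distrib)
      then have "t * b + s * b' \<le> t * c + s * d"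
        using x(2) y(2) by (simp add: divide_le_cancel)
      then have "(b - c) * t \<le> (d - b') * s"
        by (simp add: algebra_simps)
      then show ?thesis
        using x(2) y(2) by (simp add: x(1) y(1) pos_divide_le_eq pos_le_divide_eq)
    qed
    define a where "a = Sup lower"
    have "bdd_above lower"
      using le nonempty(2) by (meson bdd_aboveI ex_in_conv)
    then have a_ge: "x \<le> a" if "x \<in> lower" for x
      using that by (simp add: a_def cSup_upper)
    have a_le: "a \<le> y" if "y \<in> upper" for y
      using that le nonempty by (auto simp: a_def intro: cSup_least)
    define H where "H = {g + t *\<^sub>R (v, a) | g t. g \<in> G}"
    have "subspace H"
      unfolding subspace_def
    proof (intro conjI ballI allI)
      show "0 \<in> H"
        unfolding H_def using subspace_0[OF subG]
        by (intro CollectI exI[of _ 0]) (simp del: scaleR_Pair)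
    next
      fix x y assume "x \<in> H" "y \<in> H"
      then obtain g t h s where *: "x = g + t *\<^sub>R (v, a)" "g \<in> G" "y = h + s *\<^sub>R (v, a)" "h \<in> G"
        unfolding H_def by blast
      have "x + y = (g + h) + (t + s) *\<^sub>R (v, a)"
        by (simp only: * scaleR_left_distrib add_ac)
      then show "x + y \<in> H"
        unfolding H_def using subspace_add[OF subG *(2,4)] by blast
    next
      fix c x assume "x \<in> H"
      then obtain g t where *: "x = g + t *\<^sub>R (v, a)" "g \<in> G"
        unfolding H_def by blast
      have "c *\<^sub>R x = c *\<^sub>R g + (c * t) *\<^sub>R (v, a)"
        by (simp only: * scaleR_right_distrib scaleR_scaleR)
      then show "c *\<^sub>R x \<in> H"
        unfolding H_def using subspace_scale[OF subG *(2)] by blast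
    qed
    moreover have "e \<le> c" if "(z, e) \<in> H" "(z, c) \<in> K" for z e c
    proof -
      obtain u b t where *: "(u, b) \<in> G" "z = u + t *\<^sub>R v" "e = b + t * a"
        using \<open>(z, e) \<in> H\<close> unfolding H_def by auto
      consider "t = 0" | "t > 0" | "t < 0"
        by linarith
      then show ?thesis
      proof cases
        case 1
        then show ?thesis
          using * below that(2) by simp
      next
        case 2
        then have "(c - b) / t \<in> upper"
          using * that(2) unfolding upper_def by blast
        then show ?thesis
          using a_le 2 * by (fastforce simp: field_simps)
      next
        case 3
        have "(u - (- t) *\<^sub>R v, c) \<in> K"
          using * that(2) by simp
        then have "(b - c) / (- t) \<in> lower"
          using *(1) 3 unfolding lower_def using neg_0_less_iff_less by blast
        then have "(b - c) / (- t) \<le> a"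
          by (rule a_ge)
        then show ?thesis
          using 3 * by (simp add: field_simps)
      qed
    qed
    ultimately have "H \<in> \<A>"
      by (auto simp: \<A>_def)
    moreover have "G \<subseteq> H"
    proof
      fix g assume "g \<in> G"
      then show "g \<in> H"
        unfolding H_def by (intro CollectI exI[of _ g] exI[of _ 0]) (simp del: scaleR_Pair)
    qed
    ultimately have "H = G"
      by (rule max)
    moreover have "(v, a) \<in> H"
      unfolding H_def using subspace_0[OF subG]
      by (intro CollectI exI[of _ 0] exI[of _ 1]) (simp del: scaleR_Pair)
    ultimately show ?thesis by blast
  qed
  \<comment> \<open>Two values over the same \<open>v\<close> would put the whole vertical line over
    0 into \<open>G\<close>, including a point strictly above \<open>(0, c)\<close>.\<close>
  have unique: "a = b" if "(v, a) \<in> G" "(v, b) \<in> G" for v a b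
  proof (rule ccontr)
    assume "a \<noteq> b"
    obtain c where c: "(0, c) \<in> K"
      using absorbing[of 0] by auto
    have "((c + 1) / (a - b)) *\<^sub>R ((v, a) - (v, b)) \<in> G"
      using subG that by (intro subspace_scale subspace_diff)
    then have "(0, c + 1) \<in> G"
      using \<open>a \<noteq> b\<close> by simp
    then show False
      using below c by fastforce
  qed
  define l where "l v = (THE a. (v, a) \<in> G)" for v
  have l: "(v, l v) \<in> G" for v
    unfolding l_def using total unique by (metis theI)
  have "linear l"
  proof (rule linearI)
    show "l (x + y) = l x + l y" for x y
      using subspace_add[OF subG l[of x] l[of y]] l unique by (metis add_Pair)
    show "l (c *\<^sub>R x) = c *\<^sub>R l x" for c x
      using subspace_scale[OF subG l[of x], of c] l unique by (metis scaleR_Pair)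
  qed
  then show ?thesis
    using below l by blast
qed

text \<open>The constant bound \<open>M\<close> on a ball does double duty: it makes
  \<open>K\<close> absorbing, and it bounds the algebraic functional on that ball, which by
  linearity gives continuity.\<close>

lemma hahn_banach_blinfun:
  fixes K :: "('a::real_normed_vector \<times> real) set"
  assumes K: "convex K"
    and "r > 0" and ball: "\<And>v. norm v < r \<Longrightarrow> (v, M) \<in> K"
    and zero: "\<And>c. (0, c) \<in> K \<Longrightarrow> 0 \<le> c"
  obtains l :: "'a \<Rightarrow>\<^sub>L real" where "\<And>v c. (v, c) \<in> K \<Longrightarrow> blinfun_apply l v \<le> c"
proof -
  \<comment> \<open>Adding 1 in the denominator covers \<open>v = 0\<close> as well.\<close>
  define s where "s v = r / (2 * (norm v + 1))" for v :: 'a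
  have s_pos: "s v > 0" for v
    using \<open>r > 0\<close> by (simp add: s_def add_nonneg_pos)
  have s_norm: "norm (s v *\<^sub>R v) < r" for v
  proof -
    have "r * norm v < r * (2 * (norm v + 1))"
      using \<open>r > 0\<close> by (smt (verit) mult_strict_left_mono norm_ge_zero)
    then show ?thesis
      using \<open>r > 0\<close> s_pos[of v] by (simp add: s_def pos_divide_less_eq add_nonneg_pos)
  qed
  have absorbing: "\<exists>t>0. \<exists>c. (t *\<^sub>R v, c) \<in> K" for v
    using s_pos s_norm ball by blast
  obtain l where "linear l" and le: "\<And>v c. (v, c) \<in> K \<Longrightarrow> l v \<le> c"
    using hahn_banach_convex_set[OF K absorbing zero] by blast
  interpret linear l by fact
  have half: "l v \<le> 2 * M / r * norm v" for v
  proof (cases "v = 0")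
    case False
    define t where "t = r / (2 * norm v)"
    have "norm (t *\<^sub>R v) < r"
      using False \<open>r > 0\<close> by (simp add: t_def)
    then have "t * l v \<le> M"
      using le[OF ball, of "t *\<^sub>R v"] by (simp add: scale)
    then show ?thesis
      using False \<open>r > 0\<close> by (simp add: t_def field_simps)
  qed (simp add: zero)
  have "bounded_linear l"
  proof (unfold_locales, intro exI allI)
    show "norm (l v) \<le> norm v * (2 * M / r)" for v
      using half[of v] half[of "- v"] by (simp add: neg abs_le_iff mult.commute)
  qed
  then show ?thesis
    using that[of "Blinfun l"] le by (simp add: bounded_linear_Blinfun_apply)
qed

section \<open>Subgradients and growth of convex functions\<close>

lemma subgradient_exists:
  fixes f :: "'a::real_normed_vector \<Rightarrow> real"
  assumes f: "convex_on UNIV f" and "r > 0" and M: "\<And>x. norm (x - y) < r \<Longrightarrow> f x \<le> M"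
  obtains q :: "'a \<Rightarrow>\<^sub>L real" where "\<And>z. f y + blinfun_apply q (z - y) \<le> f z"
proof -
  \<comment> \<open>The epigraph of \<open>f\<close>, translated so that \<open>(y, f y)\<close>
    becomes the origin; a linear functional below it is a subgradient at \<open>y\<close>.\<close>
  define K where "K = {(v, c). f (y + v) - f y \<le> c}"
  have "convex K"
  proof (rule convexI)
    fix g h u v assume gh: "g \<in> K" "h \<in> K" and uv: "(0::real) \<le> u" "0 \<le> v" "u + v = 1"
    obtain g1 g2 h1 h2 where [simp]: "g = (g1, g2)" "h = (h1, h2)" by (cases g, cases h)
    have "f (u *\<^sub>R (y + g1) + v *\<^sub>R (y + h1)) \<le> u * f (y + g1) + v * f (y + h1)"
      using f uv by (simp add: convex_on_def)
    moreover have "u *\<^sub>R (y + g1) + v *\<^sub>R (y + h1) = (u + v) *\<^sub>R y + (u *\<^sub>R g1 + v *\<^sub>R h1)"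
      by (simp add: algebra_simps)
    moreover have "u * (f (y + g1) - f y) + v * (f (y + h1) - f y) \<le> u * g2 + v * h2"
      using gh uv by (intro add_mono mult_left_mono) (auto simp: K_def)
    moreover have "u * f y + v * f y = f y"
      using uv by (simp flip: distrib_right)
    ultimately have "f (y + (u *\<^sub>R g1 + v *\<^sub>R h1)) - f y \<le> u * g2 + v * h2"
      by (simp add: uv right_diff_distrib)
    then show "u *\<^sub>R g + v *\<^sub>R h \<in> K"
      by (simp add: K_def)
  qed
  then obtain q :: "'a \<Rightarrow>\<^sub>L real" where q: "\<And>v c. (v, c) \<in> K \<Longrightarrow> blinfun_apply q v \<le> c"
  proof (rule hahn_banach_blinfun[where M = "M - f y"])
    show "(v, M - f y) \<in> K" if "norm v < r" for v
      using M[of "y + v"] that by (simp add: K_def)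
    show "0 \<le> c" if "(0, c) \<in> K" for c
      using that by (simp add: K_def)
  qed (use \<open>r > 0\<close> in auto)
  have "f y + blinfun_apply q (z - y) \<le> f z" for z
    using q[of "z - y" "f z - f y"] by (simp add: K_def)
  then show ?thesis by (rule that)
qed

lemma power2_norm_convex:
  fixes x y :: "'a::real_inner"
  assumes "0 \<le> u" "0 \<le> v" "u + v = 1"
  shows "(norm (u *\<^sub>R x + v *\<^sub>R y))\<^sup>2 \<le> u * (norm x)\<^sup>2 + v * (norm y)\<^sup>2"
proof -
  have v: "v = 1 - u" using assms by simp
  have "u * (norm x)\<^sup>2 + v * (norm y)\<^sup>2 - (norm (u *\<^sub>R x + v *\<^sub>R y))\<^sup>2 = u * v * (norm (x - y))\<^sup>2"
    unfolding v power2_norm_eq_inner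
    by (simp add: inner_simps inner_commute[of y x]) algebra
  moreover have "0 \<le> u * v * (norm (x - y))\<^sup>2"
    using assms by simp
  ultimately show ?thesis by linarith
qed

text \<open>Along a ray from 0, the mean slope up to the sphere of radius \<open>R\<close> is at
  least \<open>1 / R\<close>, and by convexity it cannot decrease further out. Inside the ball the
  constant lower bound suffices.\<close>

lemma convex_coercive_linear_growth:
  fixes f :: "'a::real_normed_vector \<Rightarrow> real"
  assumes f: "convex_on UNIV f" and "R > 0" and lower: "\<And>x. m \<le> f x"
    and far: "\<And>x. norm x = R \<Longrightarrow> f 0 + 1 \<le> f x"
  shows "norm x / R - (1 + \<bar>m\<bar>) \<le> f x"
proof (cases "norm x \<le> R")
  case True
  then have "norm x / R \<le> 1"
    using \<open>R > 0\<close> by simp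
  then show ?thesis
    using lower[of x] by linarith
next
  case False
  then have x: "norm x > R" "norm x > 0" using \<open>R > 0\<close> by auto
  define t where "t = R / norm x"
  have t: "0 < t" "t < 1" using x \<open>R > 0\<close> by (auto simp: t_def)
  have "norm (t *\<^sub>R x) = R"
    using x \<open>R > 0\<close> by (simp add: t_def)
  then have "f 0 + 1 \<le> f (t *\<^sub>R x + (1 - t) *\<^sub>R 0)"
    using far by simp
  also have "\<dots> \<le> t * f x + (1 - t) * f 0"
    using f t unfolding convex_on_def by (metis UNIV_I add.commute diff_add_cancel diff_ge_0_iff_ge less_imp_le)
  finally have "1 \<le> t * (f x - f 0)"
    by (simp add: algebra_simps)
  then have "norm x / R \<le> f x - f 0"
    using x \<open>R > 0\<close> by (simp add: t_def field_simps)
  then show ?thesis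
    using lower[of 0] by linarith
qed

section \<open>The variational problem for a finite convex function\<close>

text \<open>The second conclusion is the bound on \<open>f y\<close> plus the conjugate at
  \<open>- A y\<close> plus the boundary energy by 0, written pointwise in \<open>z\<close> to avoid
  the supremum.\<close>

lemma skew_adjoint_modulo_solution:
  fixes f :: "'a::banach \<Rightarrow> real"
    and A :: "'a \<Rightarrow> ('a \<Rightarrow>\<^sub>L real)"
    and b1 :: "'a \<Rightarrow> 'h1::real_inner" and b2 :: "'a \<Rightarrow> 'h2::real_inner"
  assumes refl: "reflexive_space TYPE('a)"
    and f: "convex_on UNIV f"
    and skew: "skew_adjoint_modulo DA A Db b1 b2"
    and bounded: "\<And>R. \<exists>M. \<forall>x. norm x \<le> R \<longrightarrow> \<bar>f x\<bar> \<le> M"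
    and "r > 0" and growth: "\<And>x. r * norm x - M \<le> f x"
  obtains y where "y \<in> DA \<inter> Db"
    and "\<And>z. f y - blinfun_apply (A y) z + 1/2 * ((norm (b1 y))\<^sup>2 + (norm (b2 y))\<^sup>2) \<le> f z"
proof -
  define S where "S = DA \<inter> Db"
  define B where "B x = 1/2 * ((norm (b1 x))\<^sup>2 + (norm (b2 x))\<^sup>2)" for x
  have linA: "linear_map_on DA A" and linb: "linear_map_on Db (\<lambda>x. (b1 x, b2 x))"
    and dense_ker: "closure ({x \<in> Db. b1 x = 0 \<and> b2 x = 0} \<inter> DA) = UNIV"
    and dense_b: "closure ((\<lambda>x. (b1 x, b2 x)) ` S) = UNIV"
    and S_iff: "\<And>y. y \<in> S \<longleftrightarrow>
        (SUP x\<in>{x \<in> S. norm x < 1}. ereal (blinfun_apply (A x) y - B x)) < \<infinity>"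
    and green: "\<And>x y. x \<in> S \<Longrightarrow> y \<in> S \<Longrightarrow>
        blinfun_apply (A x) y = - blinfun_apply (A y) x + b1 x \<bullet> b1 y - b2 x \<bullet> b2 y"
    using skew unfolding skew_adjoint_modulo_def Let_def S_def B_def by blast+
  have subS: "subspace S"
    using linA linb by (auto simp: linear_map_on_def S_def intro: subspace_inter)
  have A_add: "A (x + y) = A x + A y"
    and b_add: "b1 (x + y) = b1 x + b1 y" "b2 (x + y) = b2 x + b2 y"
    if "x \<in> S" "y \<in> S" for x y
    using that linA linb by (auto simp: linear_map_on_def S_def)
  have A_scale: "A (c *\<^sub>R x) = c *\<^sub>R A x"
    and b_scale: "b1 (c *\<^sub>R x) = c *\<^sub>R b1 x" "b2 (c *\<^sub>R x) = c *\<^sub>R b2 x"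
    if "x \<in> S" for x c
    using that linA linb by (auto simp: linear_map_on_def S_def)
  have zero: "0 \<in> S" "A 0 = 0" "b1 0 = 0" "b2 0 = 0"
    using subspace_0[OF subS] A_scale[of 0 0] b_scale[of 0 0] by auto

  \<comment> \<open>Epigraph form of the infimal function, with \<open>d\<close> an upper bound of the conjugate of \<open>f\<close> at
    \<open>p - A x\<close>; this keeps all values finite.\<close>
  define K where "K = {(p, c). \<exists>x\<in>S. \<exists>d.
    (\<forall>z. blinfun_apply (p - A x) z - f z \<le> d) \<and> f x + d + B x \<le> c}"
  have "convex K"
  proof (rule convexI)
    fix g h u v assume gh: "g \<in> K" "h \<in> K" and uv: "(0::real) \<le> u" "0 \<le> v" "u + v = 1"
    obtain p c x d where g: "g = (p, c)" "x \<in> S" "f x + d + B x \<le> c"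
      and d: "\<And>z. blinfun_apply (p - A x) z - f z \<le> d"
      using gh(1) unfolding K_def by auto
    obtain p' c' x' d' where h: "h = (p', c')" "x' \<in> S" "f x' + d' + B x' \<le> c'"
      and d': "\<And>z. blinfun_apply (p' - A x') z - f z \<le> d'"
      using gh(2) unfolding K_def by auto
    define y where "y = u *\<^sub>R x + v *\<^sub>R x'"
    have S: "u *\<^sub>R x \<in> S" "v *\<^sub>R x' \<in> S" "y \<in> S"
      using g h subS by (auto simp: y_def intro: subspace_add subspace_scale)
    have "f y \<le> u * f x + v * f x'"
      using f uv by (simp add: y_def convex_on_def)
    moreover have "B y \<le> u * B x + v * B x'"
      using power2_norm_convex[OF uv, of "b1 x" "b1 x'"] power2_norm_convex[OF uv, of "b2 x" "b2 x'"]
      by (simp add: B_def y_def b_add S b_scale g h algebra_simps)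
    moreover have "u * (f x + d + B x) + v * (f x' + d' + B x') \<le> u * c + v * c'"
      using g h uv by (intro add_mono mult_left_mono)
    ultimately have "f y + (u * d + v * d') + B y \<le> u * c + v * c'"
      by (simp add: algebra_simps)
    moreover have "blinfun_apply (u *\<^sub>R p + v *\<^sub>R p' - A y) z - f z \<le> u * d + v * d'" for z
    proof -
      have "u * (blinfun_apply (p - A x) z - f z) + v * (blinfun_apply (p' - A x') z - f z)
          \<le> u * d + v * d'"
        using d d' uv by (intro add_mono mult_left_mono)
      moreover have "u * f z + v * f z = f z"
        using uv by (simp flip: distrib_right)
      ultimately show ?thesis
        using A_add[OF S(1,2)] A_scale g(2) h(2)
        by (simp add: y_def blinfun.bilinear_simps right_diff_distrib distrib_left)
    qed
    ultimately show "u *\<^sub>R g + v *\<^sub>R h \<in> K"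
      unfolding K_def g(1) h(1) using S(3) by auto
  qed
  then obtain L where L: "\<And>p c. (p, c) \<in> K \<Longrightarrow> blinfun_apply L p \<le> c"
  proof (rule hahn_banach_blinfun[where M = "f 0 + M"])
    \<comment> \<open>The witness is \<open>x = 0\<close>: linear growth with slope \<open>r\<close>
      bounds the conjugate of \<open>f\<close> by \<open>M\<close> on the ball of radius
      \<open>r\<close>.\<close>
    show "(p, f 0 + M) \<in> K" if "norm p < r" for p
    proof -
      have "blinfun_apply p z - f z \<le> M" for z
      proof -
        have "blinfun_apply p z \<le> norm p * norm z"
          using norm_blinfun[of p z] by simp
        also have "\<dots> \<le> r * norm z"
          using that by (intro mult_right_mono) auto
        finally show ?thesis
          using growth[of z] by linarith
      qed
      then show ?thesis
        using zero by (auto simp: K_def B_def intro!: bexI[of _ 0] exI[of _ M])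
    qed
    \<comment> \<open>Taking \<open>z = x\<close> in the conjugate bound is the Fenchel inequality;
      Green's formula on the diagonal then leaves the square of the norm of \<open>b2 x\<close> as a
      lower bound of \<open>c\<close>.\<close>
    show "0 \<le> c" if zK: "(0, c) \<in> K" for c
    proof -
      obtain x d where x: "x \<in> S" "f x + d + B x \<le> c"
        and d: "\<And>z. blinfun_apply (0 - A x) z - f z \<le> d"
        using zK by (auto simp: K_def)
      have "2 * blinfun_apply (A x) x = (norm (b1 x))\<^sup>2 - (norm (b2 x))\<^sup>2"
        using green[of x x] x by (simp add: power2_norm_eq_inner)
      moreover have "- blinfun_apply (A x) x - f x \<le> d"
        using d[of x] by (simp add: blinfun.bilinear_simps)
      ultimately have "(norm (b2 x))\<^sup>2 \<le> c"
        using x(2) unfolding B_def distrib_left by linarith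
      then show ?thesis
        using zero_le_power2 order_trans by blast
    qed
  qed (use \<open>r > 0\<close> in auto)
  obtain y where y: "L = canonical_embedding y"
    using refl unfolding reflexive_space_def by (metis surjD)
  obtain M1 where M1: "\<And>x. norm x \<le> norm y + 1 \<Longrightarrow> \<bar>f x\<bar> \<le> M1"
    using bounded by blast
  obtain q :: "'a \<Rightarrow>\<^sub>L real" where q: "\<And>z. f y + blinfun_apply q (z - y) \<le> f z"
  proof (rule subgradient_exists[OF f zero_less_one])
    show "f x \<le> M1" if "norm (x - y) < 1" for x
      using M1[of x] norm_triangle_ineq2[of x y] that by linarith
  qed auto
  \<comment> \<open>Choosing \<open>p = q + A x\<close> turns \<open>p - A x\<close> into the
    subgradient \<open>q\<close>, where the conjugate of \<open>f\<close> is
    \<open>blinfun_apply q y - f y\<close>; the terms in \<open>q\<close> then cancel.\<close>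
  have le: "f y + blinfun_apply (A x) y \<le> f x + B x" if "x \<in> S" for x
  proof -
    have "(q + A x, f x + (blinfun_apply q y - f y) + B x) \<in> K"
      unfolding K_def using that q
      by (auto simp: blinfun.bilinear_simps algebra_simps intro!: bexI[of _ x]
            exI[of _ "blinfun_apply q y - f y"])
    from L[OF this] show ?thesis
      by (simp add: y blinfun.bilinear_simps)
  qed
  obtain M2 where M2: "\<And>x. norm x \<le> 1 \<Longrightarrow> \<bar>f x\<bar> \<le> M2"
    using bounded by blast
  have "(SUP x\<in>{x \<in> S. norm x < 1}. ereal (blinfun_apply (A x) y - B x)) \<le> ereal (M2 - f y)"
  proof (rule SUP_least)
    fix x assume "x \<in> {x \<in> S. norm x < 1}"
    then show "ereal (blinfun_apply (A x) y - B x) \<le> ereal (M2 - f y)"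
      using le[of x] M2[of x] by simp
  qed
  then have "y \<in> S"
    using S_iff[of y] by (auto intro: le_less_trans)

  \<comment> \<open>A convex function bounded on balls is continuous; this makes the set
    \<open>T\<close> below closed.\<close>
  have "continuous_on UNIV f"
  proof -
    have "continuous_on (ball 0 n) f" for n :: real
    proof -
      obtain M' where "\<And>x. norm x \<le> n \<Longrightarrow> \<bar>f x\<bar> \<le> M'"
        using bounded by blast
      then show ?thesis
        using f by (intro convex_on_bounded_continuous[where b = M'])
          (auto intro: convex_on_subset)
    qed
    then have "continuous (at x) f" for x
      by (rule continuous_on_interior[of "ball 0 (norm x + 1)"]) simp
    then show ?thesis
      by (simp add: continuous_on_eq_continuous_at)
  qed
  \<comment> \<open>This is \<open>le\<close> rewritten by Green's formula, with the boundary values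
    \<open>b1 x\<close> and \<open>b2 x\<close> freed into independent variables.\<close>
  define T where "T = {(z, h1, h2). f y - blinfun_apply (A y) z - f z
      + (h1 \<bullet> b1 y - 1/2 * (norm h1)\<^sup>2) - (h2 \<bullet> b2 y + 1/2 * (norm h2)\<^sup>2) \<le> 0}"
  have "closed T"
    unfolding T_def case_prod_beta
    by (intro closed_Collect_le continuous_intros continuous_on_compose2[OF \<open>continuous_on UNIV f\<close>]) auto
  moreover have "(\<lambda>x. (x, b1 x, b2 x)) ` S \<subseteq> T"
  proof (clarsimp simp: T_def)
    fix x assume "x \<in> S"
    then show "f y - blinfun_apply (A y) x - f x + (b1 x \<bullet> b1 y - (norm (b1 x))\<^sup>2 / 2)
        \<le> b2 x \<bullet> b2 y + (norm (b2 x))\<^sup>2 / 2"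
      using le[of x] green[OF \<open>x \<in> S\<close> \<open>y \<in> S\<close>]
      by (simp add: B_def add_divide_distrib)
  qed
  ultimately have closure_T: "closure ((\<lambda>x. (x, b1 x, b2 x)) ` S) \<subseteq> T"
    by (rule closure_minimal[rotated])
  \<comment> \<open>First \<open>s\<close> approximates the boundary values by condition (3); then
    \<open>k\<close> from the kernel, dense by condition (2), moves \<open>s\<close> close to
    \<open>z\<close> without changing them.\<close>
  have dense: "(z, h) \<in> closure ((\<lambda>x. (x, b1 x, b2 x)) ` S)" for z h
  proof (subst closure_approachable, intro allI impI)
    fix e :: real assume "e > 0"
    then have e2: "e / 2 > 0" by simp
    obtain s where s: "s \<in> S" "dist (b1 s, b2 s) h < e / 2"
      using dense_b closure_approachable[of h "(\<lambda>x. (b1 x, b2 x)) ` S"] e2 by fastforce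
    obtain k where k: "k \<in> Db" "b1 k = 0" "b2 k = 0" "k \<in> DA" "dist k (z - s) < e / 2"
      using dense_ker closure_approachable[of "z - s" "{x \<in> Db. b1 x = 0 \<and> b2 x = 0} \<inter> DA"] e2
      by fastforce
    have "k \<in> S" using k by (simp add: S_def)
    then have "s + k \<in> S" using s subS by (auto intro: subspace_add)
    moreover have "dist (s + k, b1 (s + k), b2 (s + k)) (z, h) < e"
    proof -
      have "dist (s + k) z < e / 2"
        using k(5) by (simp add: dist_norm algebra_simps)
      moreover have "dist (b1 (s + k), b2 (s + k)) h < e / 2"
        using s k b_add[OF \<open>s \<in> S\<close> \<open>k \<in> S\<close>] by simp
      ultimately show ?thesis
        using sqrt_sum_squares_le_sum[of "dist (s + k) z" "dist (b1 (s + k), b2 (s + k)) h"]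
        by (simp add: dist_Pair_Pair)
    qed
    ultimately show "\<exists>w\<in>(\<lambda>x. (x, b1 x, b2 x)) ` S. dist w (z, h) < e"
      by blast
  qed
  have "f y - blinfun_apply (A y) z + B y \<le> f z" for z
  proof -
    \<comment> \<open>These boundary values maximize the two concave quadratic terms in
      \<open>T\<close>, whose maxima add up to \<open>B y\<close>.\<close>
    have "(z, b1 y, - b2 y) \<in> T"
      using dense closure_T by blast
    then show ?thesis
      by (simp add: T_def B_def power2_norm_eq_inner add_divide_distrib)
  qed
  then show ?thesis
    using that \<open>y \<in> S\<close> by (simp add: S_def B_def)
qed

section \<open>Reduction to finite values and the boundary condition\<close>

theorem proposition3p2:
  fixes \<phi> :: "'a::banach \<Rightarrow> ereal"
    and DA :: "'a set" and A :: "'a \<Rightarrow> ('a \<Rightarrow>\<^sub>L real)"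
    and Db :: "'a set"
    and b1 :: "'a \<Rightarrow> 'h1::{real_inner, complete_space}"
    and b2 :: "'a \<Rightarrow> 'h2::{real_inner, complete_space}"
    and C p1 p2 :: real
  assumes "reflexive_space TYPE('a)"
    and "proper_fun \<phi>" and "convex_fun \<phi>" and "lsc_fun \<phi>"
    and "skew_adjoint_modulo DA A Db b1 b2"
    and "C > 0" and "p1 > 0" and "p2 > 0"
    and "\<And>x. ereal (1 / C * (norm x powr p1 - 1)) \<le> \<phi> x"
    and "\<And>x. \<phi> x \<le> ereal (C * (norm x powr p2 + 1))"
  shows "\<exists>x \<in> DA \<inter> Db.
    \<phi> x + fenchel_conjugate \<phi> (- A x)
        + ereal (1/2 * (norm (b1 x))\<^sup>2) + ereal (1/2 * (norm (b2 x))\<^sup>2) = 0 \<and>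
    - A x \<in> subdifferential \<phi> x \<and> b2 x = 0"
proof -
  \<comment> \<open>The two growth bounds make \<phi> finite everywhere, so it may be treated as a
    real function.\<close>
  define f where "f x = real_of_ereal (\<phi> x)" for x
  have \<phi>: "\<phi> x = ereal (f x)" for x
    using assms(9)[of x] assms(10)[of x] by (cases "\<phi> x") (auto simp: f_def)
  have lower: "1 / C * (norm x powr p1 - 1) \<le> f x" and upper: "f x \<le> C * (norm x powr p2 + 1)" for x
    using assms(9)[of x] assms(10)[of x] by (simp_all add: \<phi>)
  have f: "convex_on UNIV f"
    using assms(3) by (auto simp: convex_on_def convex_fun_def \<phi>)
  have below: "- (1 / C) \<le> f x" for x
  proof -
    have "1 / C * (-1) \<le> 1 / C * (norm x powr p1 - 1)"
      using \<open>C > 0\<close> by (intro mult_left_mono) auto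
    then show ?thesis
      using lower[of x] by simp
  qed
  have bounded: "\<exists>M. \<forall>x. norm x \<le> R \<longrightarrow> \<bar>f x\<bar> \<le> M" for R
  proof (intro exI allI impI)
    fix x :: 'a assume "norm x \<le> R"
    then have "C * (norm x powr p2 + 1) \<le> C * (R powr p2 + 1)"
      using \<open>C > 0\<close> \<open>p2 > 0\<close> by (intro mult_left_mono add_right_mono powr_mono2) auto
    then show "\<bar>f x\<bar> \<le> 1 / C + C * (R powr p2 + 1)"
      using upper[of x] below[of x] \<open>C > 0\<close>
      by (smt (verit) divide_pos_pos mult_nonneg_nonneg powr_ge_zero)
  qed
  \<comment> \<open>On the sphere of radius \<open>R\<close> the lower growth bound equals
    \<open>(t - 1) / C\<close>, that is \<open>\<bar>f 0\<bar> + 1\<close>.\<close>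
  define t where "t = C * (\<bar>f 0\<bar> + 1) + 1"
  define R where "R = t powr (1 / p1)"
  have "t > 0"
    using \<open>C > 0\<close> by (simp add: t_def add_nonneg_pos)
  then have "R > 0" "R powr p1 = t"
    using \<open>p1 > 0\<close> by (simp_all add: R_def powr_powr)
  have growth: "1 / R * norm x - (1 + \<bar>- (1 / C)\<bar>) \<le> f x" for x
  proof -
    have "f 0 + 1 \<le> f x" if "norm x = R" for x
      using lower[of x] \<open>C > 0\<close> that by (simp add: \<open>R powr p1 = t\<close>) (simp add: t_def)
    from convex_coercive_linear_growth[OF f \<open>R > 0\<close> below this, of x] show ?thesis
      by simp
  qed
  obtain y where y: "y \<in> DA \<inter> Db"
    and le: "\<And>z. f y - blinfun_apply (A y) z + 1/2 * ((norm (b1 y))\<^sup>2 + (norm (b2 y))\<^sup>2) \<le> f z"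
    using skew_adjoint_modulo_solution[OF assms(1) f assms(5) bounded _ growth] \<open>R > 0\<close> by auto
  have "blinfun_apply (A y) y = - blinfun_apply (A y) y + b1 y \<bullet> b1 y - b2 y \<bullet> b2 y"
    using assms(5) y unfolding skew_adjoint_modulo_def Let_def by blast
  then have Ay: "2 * blinfun_apply (A y) y = (norm (b1 y))\<^sup>2 - (norm (b2 y))\<^sup>2"
    by (simp add: power2_norm_eq_inner)
  \<comment> \<open>The case \<open>z = y\<close> against Green's formula on the diagonal forces
    twice the square of the norm of \<open>b2 y\<close> to be at most 0.\<close>
  moreover have "(norm (b1 y))\<^sup>2 + (norm (b2 y))\<^sup>2 \<le> 2 * blinfun_apply (A y) y"
    using le[of y] by simp
  ultimately have b2: "b2 y = 0"
    using zero_less_norm_iff[of "b2 y"] zero_less_power[of "norm (b2 y)" 2] by linarith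
  \<comment> \<open>Once \<open>b2 y = 0\<close>, the boundary energy equals
    \<open>blinfun_apply (A y) y\<close>, so \<open>le\<close> becomes the subgradient inequality
    for \<open>- A y\<close>.\<close>
  have sub: "f y - blinfun_apply (A y) (z - y) \<le> f z" for z
    using le[of z] Ay b2 by (simp add: blinfun.bilinear_simps)
  have "fenchel_conjugate \<phi> (- A y) = ereal (- blinfun_apply (A y) y - f y)"
    unfolding fenchel_conjugate_def
  proof (rule antisym)
    show "(SUP z. ereal (blinfun_apply (- A y) z) - \<phi> z) \<le> ereal (- blinfun_apply (A y) y - f y)"
      using sub by (intro SUP_least) (simp add: \<phi> blinfun.bilinear_simps algebra_simps)
    show "ereal (- blinfun_apply (A y) y - f y) \<le> (SUP z. ereal (blinfun_apply (- A y) z) - \<phi> z)"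
      by (intro SUP_upper2[of y]) (simp_all add: \<phi> blinfun.bilinear_simps)
  qed
  then have "\<phi> y + fenchel_conjugate \<phi> (- A y)
      + ereal (1/2 * (norm (b1 y))\<^sup>2) + ereal (1/2 * (norm (b2 y))\<^sup>2) = 0"
    using Ay b2 by (simp add: \<phi> zero_ereal_def)
  moreover have "- A y \<in> subdifferential \<phi> y"
    using sub by (simp add: subdifferential_def \<phi> blinfun.bilinear_simps algebra_simps)
  ultimately show ?thesis
    using y b2 by blast
qed

end
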